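(* Let $G$ be a two-layer network with layers $G_1$ ($n$ nodes) and $G_2$ ($m$ nodes) and set of admissible interlayer links $E_3$, and let $c\ge 0$. Let $W$ be the $n\times m$ matrix of a nonnegative interlayer weight assignment $w$ of total weight $c$. If the upper bound is attained by $w$, i.e. $\lambda_2[L(w)]=\left(\frac1n+\frac1m\right)c$, then $$W\boldsymbol 1_m\in\mathrm{span}\{\boldsymbol 1_n\},\qquad W^T\boldsymbol 1_n\in\mathrm{span}\{\boldsymbol 1_m\},$$ that is, $W$ has constant row sums and constant column sums.
   Context: Let $G_1=(V_1,E_1)$ and $G_2=(V_2,E_2)$ be finite undirected (unweighted) graphs on disjoint vertex sets with $|V_1|=n\ge1$, $|V_2|=m\ge1$, and Laplacian matrices $L_1,L_2$. Let $E_3\subseteq\{\{i,j\}:i\in V_1,j\in V_2\}$ be a nonempty set of interlayer links, with nonnegative weights $w=(w_{ij})_{\{i,j\}\in E_3}$. Let $W=[w_{ij}]$ be the $n\times m$ nonnegative matrix of interlayer weights (with $w_{ij}=0$ if $\{i,j\}\notin E_3$); the total weight is $\boldsymbol 1_n^TW\boldsymbol 1_m$. The (supra-)Laplacian is $$L(w)=\begin{bmatrix} L_1+\mathrm{diag}(W\boldsymbol 1_m) & -W\\ -W^T & L_2+\mathrm{diag}(W^T\boldsymbol 1_n)\end{bmatrix},$$ where $\boldsymbol 1_k$ is the all-ones vector in $\mathbb R^k$. The algebraic connectivity $\lambda_2[L]$ is the second smallest eigenvalue (with multiplicity) of $L$, i.e. $\lambda_2[L]=\min\{v^TLv/\|v\|^2: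 v\ne0,\ v^T\boldsymbol 1_{n+m}=0\}$. (The quantity $(\frac1n+\frac1m)c$ is an upper bound for $\lambda_2[L(w)]$ over all nonnegative weight assignments of total weight $c$.) *)

theory Defs
  imports "Jordan_Normal_Form.Char_Poly" "Jordan_Normal_Form.VS_Connect"
begin

definition simple_graph :: "'v set \<Rightarrow> 'v set set \<Rightarrow> bool" where
  "simple_graph V E \<longleftrightarrow> finite V \<and> E \<subseteq> {{u, v} | u v. u \<in> V \<and> v \<in> V \<and> u \<noteq> v}"

(* Matrix rows and columns are numbered from 0. The vertices of a layer are numbered by a
   function a which is a bijection from {0..<n} onto the vertex set; the vertex a i belongs to
   row i. *)

definition degree_mat :: "nat \<Rightarrow> (nat \<Rightarrow> 'v) \<Rightarrow> 'v set set \<Rightarrow> real mat" where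
  "degree_mat n a E = mat_diag n (\<lambda>i. real (card {e \<in> E. a i \<in> e}))"

definition adjacency_mat :: "nat \<Rightarrow> (nat \<Rightarrow> 'v) \<Rightarrow> 'v set set \<Rightarrow> real mat" where
  "adjacency_mat n a E = mat n n (\<lambda>(i, j). if {a i, a j} \<in> E then 1 else 0)"

definition laplacian_mat :: "nat \<Rightarrow> (nat \<Rightarrow> 'v) \<Rightarrow> 'v set set \<Rightarrow> real mat" where
  "laplacian_mat n a E = degree_mat n a E - adjacency_mat n a E"

definition interlayer_mat ::
  "nat \<Rightarrow> (nat \<Rightarrow> 'v) \<Rightarrow> nat \<Rightarrow> (nat \<Rightarrow> 'v) \<Rightarrow> 'v set set \<Rightarrow> ('v set \<Rightarrow> real) \<Rightarrow> real mat" where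
  "interlayer_mat n a m b E3 w =
     mat n m (\<lambda>(i, j). if {a i, b j} \<in> E3 then w {a i, b j} else 0)"

definition ones_vec :: "nat \<Rightarrow> real vec" where
  "ones_vec k = vec k (\<lambda>_. 1)"

definition diag_of_vec :: "real vec \<Rightarrow> real mat" where
  "diag_of_vec v = mat_diag (dim_vec v) (\<lambda>i. v $ i)"

definition supra_laplacian :: "real mat \<Rightarrow> real mat \<Rightarrow> real mat \<Rightarrow> real mat" where
  "supra_laplacian L1 L2 W = four_block_mat
     (L1 + diag_of_vec (W *\<^sub>v ones_vec (dim_col W)))  (- W)
     (- (W\<^sup>T))  (L2 + diag_of_vec (W\<^sup>T *\<^sub>v ones_vec (dim_row W)))"

(* The real eigenvalues in increasing order, each repeated according to its multiplicity as a
   root of the characteristic polynomial. For a real symmetric matrix, the only case of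
   interest here, these are all the eigenvalues. *)
definition sorted_eigenvalues :: "real mat \<Rightarrow> real list" where
  "sorted_eigenvalues A = sorted_list_of_multiset (proots (char_poly A))"

definition algebraic_connectivity :: "real mat \<Rightarrow> real" where
  "algebraic_connectivity L = sorted_eigenvalues L ! 1"

abbreviation vec_span :: "nat \<Rightarrow> real vec set \<Rightarrow> real vec set" where
  "vec_span k \<equiv> LinearCombinations.module.span class_ring (module_vec TYPE(real) k)"

end

theory Submission
  imports Defs "Jordan_Normal_Form.Spectral_Radius"
begin

text \<open>The vector \<open>x\<close> with entries \<open>1/n\<close> on the first layer and \<open>-1/m\<close> on the second is orthogonal
  to the constants, and its Rayleigh quotient is \<open>(1/n + 1/m) c\<close>. If this equals \<open>\<lambda>\<^sub>2\<close>, then \<open>x\<close>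
  minimises the Rayleigh quotient on the complement of the constants, so a first-order variation shows
  \<open>L x = \<lambda>\<^sub>2 x\<close>. As \<open>L x\<close> is \<open>(1/n + 1/m) W 1\<close> on the first layer and \<open>-(1/n + 1/m) W\<^sup>T 1\<close> on
  the second, all row sums and all column sums are constant. That \<open>\<lambda>\<^sub>2\<close>, read off the characteristic
  polynomial, bounds the Rayleigh quotient from below comes from deflating symmetric matrices by
  Householder reflections, first along the constant vector.\<close>

section \<open>Deflation of real symmetric matrices\<close>

text \<open>Interchanging two finite sums needs no more than a commutative semiring, so the rule
  serves the complex vectors of the next argument as well as the real ones later.\<close>

lemma scalar_prod_mult_mat_vec:
  fixes A :: "'a :: comm_semiring_0 mat"
  assumes A: "A \<in> carrier_mat nr nc" and u: "u \<in> carrier_vec nc" and v: "v \<in> carrier_vec nr"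
  shows "(A *\<^sub>v u) \<bullet> v = u \<bullet> (A\<^sup>T *\<^sub>v v)"
proof -
  have "(A *\<^sub>v u) \<bullet> v = (\<Sum>i<nr. \<Sum>j<nc. A $$ (i, j) * u $ j * v $ i)"
    using A u v by (auto simp: scalar_prod_def sum_distrib_right atLeast0LessThan intro!: sum.cong)
  also have "\<dots> = (\<Sum>j<nc. \<Sum>i<nr. A $$ (i, j) * u $ j * v $ i)"
    by (rule sum.swap)
  also have "\<dots> = u \<bullet> (A\<^sup>T *\<^sub>v v)"
    using A u v by (auto simp: scalar_prod_def sum_distrib_left atLeast0LessThan ac_simps intro!: sum.cong)
  finally show ?thesis .
qed

lemma real_scalar_prod_self_pos:
  fixes v :: "real vec"
  assumes "v \<in> carrier_vec n" and "v \<noteq> 0\<^sub>v n"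
  shows "v \<bullet> v > 0"
  using assms conjugate_square_greater_0_vec[of v n] by simp

text \<open>Over the complex numbers some eigenvector \<open>z\<close> exists. As the entries of
  \<open>A\<close> are real, \<open>conjugate z\<close> belongs to the conjugate eigenvalue; moving
  the symmetric matrix across \<open>z \<bullet>c z\<close> then equates \<open>k\<close> with its
  conjugate, so \<open>k\<close> is a real root.\<close>

lemma symmetric_mat_has_root:
  fixes A :: "real mat"
  assumes A: "A \<in> carrier_mat n n" and sym: "A\<^sup>T = A" and n: "n > 0"
  obtains k where "poly (char_poly A) k = 0"
proof -
  let ?C = "map_mat complex_of_real A"
  have C: "?C \<in> carrier_mat n n" using A by auto
  have symC: "?C\<^sup>T = ?C" using sym by (metis map_mat_transpose)
  obtain k where "eigenvalue ?C k"
    using spectrum_non_empty[OF C n] by (auto simp: spectrum_def)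
  then obtain z where z: "z \<in> carrier_vec n" "z \<noteq> 0\<^sub>v n" and Cz: "?C *\<^sub>v z = k \<cdot>\<^sub>v z"
    using A by (auto simp: eigenvalue_def eigenvector_def)
  have cz: "conjugate z \<in> carrier_vec n" using z by auto
  have "?C *\<^sub>v conjugate z = conjugate (?C *\<^sub>v z)"
    using A z by (intro eq_vecI) (auto simp: scalar_prod_def sum_conjugate)
  also have "\<dots> = cnj k \<cdot>\<^sub>v conjugate z"
    unfolding Cz by (simp add: conjugate_smult_vec)
  finally have Ccz: "?C *\<^sub>v conjugate z = cnj k \<cdot>\<^sub>v conjugate z" .
  have "k * (z \<bullet>c z) = (?C *\<^sub>v z) \<bullet>c z"
    unfolding Cz using z by simp
  also have "\<dots> = z \<bullet> (?C *\<^sub>v conjugate z)"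
    using scalar_prod_mult_mat_vec[OF C z(1) cz] symC by simp
  also have "\<dots> = cnj k * (z \<bullet>c z)"
    unfolding Ccz using z by simp
  finally have "k = cnj k" using z by simp
  then obtain r where r: "k = complex_of_real r"
    by (metis Reals_cnj_iff Reals_cases)
  have "poly (char_poly ?C) k = 0"
    using \<open>eigenvalue ?C k\<close> eigenvalue_root_char_poly[OF C] by simp
  hence "poly (char_poly A) r = 0"
    unfolding r of_real_hom.char_poly_hom[OF A] by simp
  thus thesis by (rule that)
qed

text \<open>The sign \<open>s\<close> is chosen so that \<open>u + s\<parallel>u\<parallel>e\<^sub>0\<close> cannot vanish.\<close>

lemma householder:
  fixes u :: "real vec"
  assumes u: "u \<in> carrier_vec (Suc k)" and u0: "u \<noteq> 0\<^sub>v (Suc k)"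
  obtains H \<alpha> where "H \<in> carrier_mat (Suc k) (Suc k)" "H\<^sup>T = H" "H * H = 1\<^sub>m (Suc k)"
    "H *\<^sub>v unit_vec (Suc k) 0 = \<alpha> \<cdot>\<^sub>v u"
proof -
  define N where "N = Suc k"
  define r where "r = sqrt (u \<bullet> u)"
  define s :: real where "s = (if u $ 0 \<ge> 0 then 1 else - 1)"
  define x where "x = u + (s * r) \<cdot>\<^sub>v unit_vec N 0"
  define g where "g = 2 / (x \<bullet> x)"
  \<comment> \<open>The reflection \<open>1 - g x x^T\<close> in the hyperplane orthogonal to
    \<open>x\<close>; it sends \<open>u\<close> to a multiple of the first unit vector, and
    back.\<close>
  define H where "H = mat N N (\<lambda>(i, j). (if i = j then 1 else 0) - g * x $ i * x $ j)"
  have uu: "u \<bullet> u > 0" using real_scalar_prod_self_pos[OF u u0] .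
  hence r: "r > 0" and r2: "r * r = u \<bullet> u" by (auto simp: r_def)
  have s2: "s * s = 1" and s0: "s * u $ 0 \<ge> 0" by (auto simp: s_def)
  have uN: "u \<in> carrier_vec N" using u by (simp add: N_def)
  have x: "x \<in> carrier_vec N" using uN by (auto simp: x_def)
  have e: "unit_vec N 0 \<in> carrier_vec N" by simp
  have N0: "0 < N" by (simp add: N_def)
  have "x \<bullet> x = u \<bullet> u + s * r * u $ 0 + (s * r * u $ 0 + s * r * (s * r))"
    unfolding x_def using uN e N0
    by (simp add: scalar_prod_add_distrib[of _ N] add_scalar_prod_distrib[of _ N] algebra_simps)
  also have "s * r * (s * r) = s * s * (r * r)" by (simp only: ac_simps)
  finally have xx: "x \<bullet> x = 2 * (r * (r + s * u $ 0))"
    by (simp add: r2[symmetric] s2 algebra_simps)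
  \<comment> \<open>Since \<open>s * u $ 0\<close> is nonnegative, no cancellation can occur in
    \<open>x\<close>, and \<open>g\<close> is a genuine quotient.\<close>
  have pos: "r + s * u $ 0 > 0" using r s0 by simp
  hence "x \<bullet> x > 0" unfolding xx using r by simp
  hence gx: "g * (x \<bullet> x) = 2" by (simp add: g_def)
  have H: "H \<in> carrier_mat N N" by (simp add: H_def)
  have sumx: "(\<Sum>l = 0..<N. x $ l * x $ l) = x \<bullet> x"
    using x by (auto simp: scalar_prod_def)
  have "H * H = 1\<^sub>m N"
  proof (rule eq_matI)
    fix i j assume "i < dim_row (1\<^sub>m N :: real mat)" "j < dim_col (1\<^sub>m N :: real mat)"
    hence ij: "i < N" "j < N" by auto
    have "(H * H) $$ (i, j) = (\<Sum>l = 0..<N. ((if i = l then 1 else 0) - g * x $ i * x $ l)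
        * ((if l = j then 1 else 0) - g * x $ l * x $ j))"
      using ij by (simp add: H_def scalar_prod_def)
    \<comment> \<open>The Kronecker deltas are isolated so that each collapses its sum to one term.
      What remains besides the identity is \<open>(g * (x \<bullet> x) - 2)\<close> times
      \<open>g * x $ i * x $ j\<close>, which vanishes by \<open>gx\<close>.\<close>
    also have "\<dots> = (\<Sum>l = 0..<N. (if l = i then (if i = j then 1 else 0) - g * x $ i * x $ j else 0)
        - (if l = j then g * x $ i * x $ j else 0)
        + g * g * x $ i * x $ j * (x $ l * x $ l))"
      by (rule sum.cong) (auto simp: algebra_simps)
    also have "\<dots> = (if i = j then 1 else 0) - 2 * (g * x $ i * x $ j)
        + g * g * x $ i * x $ j * (x \<bullet> x)"
      using ij by (simp add: sum.distrib sum_subtractf sum_distrib_left[symmetric] sumx)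
    also have "g * g * x $ i * x $ j * (x \<bullet> x) = (g * (x \<bullet> x)) * (g * x $ i * x $ j)"
      by (simp only: ac_simps)
    finally show "(H * H) $$ (i, j) = 1\<^sub>m N $$ (i, j)"
      unfolding gx using ij by simp
  qed (simp_all add: H_def)
  moreover have "H\<^sup>T = H"
    by (rule eq_matI) (auto simp: H_def)
  \<comment> \<open>Reflecting in \<open>x\<close> sends \<open>u\<close> to
    \<open>- (s * r)\<close> times the unit vector; inverting this, with \<open>s * s = 1\<close>,
    gives the factor \<open>- (s / r)\<close>.\<close>
  moreover have "H *\<^sub>v unit_vec N 0 = (- (s / r)) \<cdot>\<^sub>v u"
  proof (rule eq_vecI)
    fix i assume "i < dim_vec ((- (s / r)) \<cdot>\<^sub>v u)"
    hence i: "i < N" using uN by simp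
    have "(s * u $ 0 + r) * g * r = 1"
      using gx unfolding xx by (simp add: algebra_simps)
    hence "s * ((s * u $ 0 + r) * g * r) = s" by simp
    moreover have "s * (s * u $ 0 + r) = x $ 0"
      using uN N0 s2 by (simp add: x_def distrib_left mult.assoc[symmetric])
    ultimately have "x $ 0 * g * r = s" by (simp only: mult.assoc[symmetric])
    hence gx0: "g * x $ 0 = s / r" using r by (simp add: field_simps)
    have "(H *\<^sub>v unit_vec N 0) $ i = (if i = 0 then 1 else 0) - x $ i * (g * x $ 0)"
      using i N0 by (simp add: H_def)
    also have "\<dots> = - (s / r) * u $ i"
      unfolding gx0 using i uN N0 r s2 by (simp add: x_def field_simps)
    finally show "(H *\<^sub>v unit_vec N 0) $ i = ((- (s / r)) \<cdot>\<^sub>v u) $ i"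
      using i uN by simp
  qed (use uN H in simp)
  ultimately show thesis using H that unfolding N_def by blast
qed

text \<open>In the orthonormal coordinates given by a Householder reflection, \<open>u\<close> lies
  along the first axis. The first column of the transformed matrix is then \<open>l\<close> followed
  by zeros, symmetry clears the first row too, and \<open>B\<close> is the remaining block. The last
  conclusion transports quadratic forms and norms, with \<open>t\<close> the coordinate of
  \<open>v\<close> along \<open>u\<close>.\<close>

lemma symmetric_mat_deflation:
  fixes A :: "real mat" and l :: real
  assumes A: "A \<in> carrier_mat (Suc k) (Suc k)" and sym: "A\<^sup>T = A"
    and u: "u \<in> carrier_vec (Suc k)" "u \<noteq> 0\<^sub>v (Suc k)" and Au: "A *\<^sub>v u = l \<cdot>\<^sub>v u"
  obtains B where "B \<in> carrier_mat k k" "B\<^sup>T = B" "char_poly A = [:- l, 1:] * char_poly B"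
    "\<And>v. v \<in> carrier_vec (Suc k) \<Longrightarrow> \<exists>t y. y \<in> carrier_vec k \<and>
       v \<bullet> (A *\<^sub>v v) = l * t\<^sup>2 + y \<bullet> (B *\<^sub>v y) \<and> v \<bullet> v = t\<^sup>2 + y \<bullet> y \<and> (u \<bullet> v = 0 \<longrightarrow> t = 0)"
proof -
  let ?N = "Suc k"
  let ?e = "unit_vec ?N 0 :: real vec"
  obtain H \<alpha> where H: "H \<in> carrier_mat ?N ?N" and HT: "H\<^sup>T = H" and HH: "H * H = 1\<^sub>m ?N"
    and He: "H *\<^sub>v ?e = \<alpha> \<cdot>\<^sub>v u"
    using householder[OF u] .
  define C where "C = H * A * H"
  have C: "C \<in> carrier_mat ?N ?N" using H A by (simp add: C_def)
  have HHv: "H *\<^sub>v (H *\<^sub>v v) = v" if "v \<in> carrier_vec ?N" for v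
    using assoc_mult_mat_vec[OF H H that] HH that by simp
  have Cv: "C *\<^sub>v v = H *\<^sub>v (A *\<^sub>v (H *\<^sub>v v))" if "v \<in> carrier_vec ?N" for v
    using that H A by (simp add: C_def assoc_mult_mat_vec[of _ ?N ?N _ ?N])
  have CT: "C\<^sup>T = C"
    using H A unfolding C_def
    by (simp add: transpose_mult[of _ ?N ?N _ ?N] HT sym assoc_mult_mat[of _ ?N ?N _ ?N _ ?N])
  have "C *\<^sub>v ?e = H *\<^sub>v (A *\<^sub>v (\<alpha> \<cdot>\<^sub>v u))" by (simp add: Cv He)
  also have "\<dots> = l \<cdot>\<^sub>v (H *\<^sub>v (\<alpha> \<cdot>\<^sub>v u))"
    using u H A by (simp add: mult_mat_vec[of _ ?N ?N] Au smult_smult_assoc mult.commute)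
  also have "\<dots> = l \<cdot>\<^sub>v ?e" using HHv[of ?e] by (simp add: He)
  finally have Ce: "C *\<^sub>v ?e = l \<cdot>\<^sub>v ?e" .
  have Ci0: "C $$ (i, 0) = (if i = 0 then l else 0)" if "i < ?N" for i
    using arg_cong[OF Ce, of "\<lambda>v. v $ i"] that C by simp
  have C0i: "C $$ (0, i) = (if i = 0 then l else 0)" if "i < ?N" for i
    using Ci0[OF that] that C CT index_transpose_mat(1)[of i C 0] by simp
  define B where "B = mat k k (\<lambda>(i, j). C $$ (Suc i, Suc j))"
  define D where "D = mat 1 1 (\<lambda>_. l)"
  have B: "B \<in> carrier_mat k k" by (simp add: B_def)
  have D: "D \<in> carrier_mat 1 1" by (simp add: D_def)
  have Cblock: "C = four_block_mat D (0\<^sub>m 1 k) (0\<^sub>m k 1) B"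
    by (rule eq_matI) (use C Ci0 C0i in \<open>auto simp: B_def D_def\<close>)
  have "C $$ (Suc i, Suc j) = C $$ (Suc j, Suc i)" if "i < k" "j < k" for i j
    using CT index_transpose_mat(1)[of "Suc i" C "Suc j"] C that by simp
  hence BT: "B\<^sup>T = B"
    by (intro eq_matI) (auto simp: B_def)
  have "A = H * C * H"
  proof -
    have "H * C * H = (H * H) * A * (H * H)"
      using H A unfolding C_def by (simp add: assoc_mult_mat[of _ ?N ?N _ ?N _ ?N])
    thus ?thesis using A unfolding HH by simp
  qed
  \<comment> \<open>\<open>H\<close> is its own inverse, so it serves on both sides of the
    similarity.\<close>
  hence "similar_mat A C"
    unfolding similar_mat_def similar_mat_wit_def Let_def using H A C HH
    by (intro exI[of _ H]) auto
  hence "char_poly A = char_poly C" by (rule char_poly_similar)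
  also have "\<dots> = char_poly D * char_poly B"
    unfolding Cblock by (rule char_poly_four_block_zeros_col[OF D _ B]) simp
  also have "char_poly D = [:- l, 1:]"
    by (simp add: D_def char_poly_defs det_def sign_def)
  finally have cp: "char_poly A = [:- l, 1:] * char_poly B" .
  show thesis
  proof (rule that[OF B BT cp])
    fix v :: "real vec" assume v: "v \<in> carrier_vec ?N"
    define z where "z = H *\<^sub>v v"
    have z: "z \<in> carrier_vec ?N" using H v by (simp add: z_def)
    define t where "t = z $ 0"
    define y where "y = vec_last z k"
    have y: "y \<in> carrier_vec k" by (simp add: y_def)
    have t1: "vec 1 (\<lambda>_. t) \<in> carrier_vec 1" by simp
    have zs: "z = vec 1 (\<lambda>_. t) @\<^sub>v y"
      by (rule eq_vecI) (use z in \<open>auto simp: t_def y_def vec_last_def\<close>)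
    have Dt: "D *\<^sub>v vec 1 (\<lambda>_. t) = vec 1 (\<lambda>_. l * t)"
      by (rule eq_vecI) (auto simp: D_def scalar_prod_def)
    have Av: "A *\<^sub>v v \<in> carrier_vec ?N" using A v by simp
    have adj: "(H *\<^sub>v p) \<bullet> q = p \<bullet> (H *\<^sub>v q)" if "p \<in> carrier_vec ?N" "q \<in> carrier_vec ?N" for p q
      using scalar_prod_mult_mat_vec[OF H that] HT by simp
    have Cz: "C *\<^sub>v z = H *\<^sub>v (A *\<^sub>v v)"
      using Cv[OF z] HHv[OF v] by (simp add: z_def)
    have "v \<bullet> (A *\<^sub>v v) = v \<bullet> (H *\<^sub>v (C *\<^sub>v z))" unfolding Cz HHv[OF Av] ..
    also have "\<dots> = z \<bullet> (C *\<^sub>v z)"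
      unfolding z_def by (rule adj[symmetric, OF v]) (use H C v in simp)
    also have "\<dots> = l * t\<^sup>2 + y \<bullet> (B *\<^sub>v y)"
      unfolding zs Cblock mult_mat_vec_split[OF D B t1 y] Dt
      by (subst scalar_prod_append[of _ 1 _ k]) (use y B in \<open>auto simp: scalar_prod_def power2_eq_square\<close>)
    finally have q: "v \<bullet> (A *\<^sub>v v) = l * t\<^sup>2 + y \<bullet> (B *\<^sub>v y)" .
    have "v \<bullet> v = v \<bullet> (H *\<^sub>v z)" unfolding z_def HHv[OF v] ..
    also have "\<dots> = z \<bullet> z" unfolding z_def by (rule adj[symmetric, OF v]) (use H v in simp)
    also have "\<dots> = t\<^sup>2 + y \<bullet> y"
      unfolding zs by (subst scalar_prod_append[of _ 1 _ k]) (use y in \<open>auto simp: scalar_prod_def power2_eq_square\<close>)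
    finally have nrm: "v \<bullet> v = t\<^sup>2 + y \<bullet> y" .
    \<comment> \<open>Moving \<open>H\<close> onto the unit vector turns the first coordinate into a
      multiple of the product with \<open>u\<close>, so it vanishes on the complement of
      \<open>u\<close>.\<close>
    have "t = ?e \<bullet> z" using z by (simp add: t_def)
    also have "\<dots> = (H *\<^sub>v ?e) \<bullet> v" unfolding z_def by (rule adj[symmetric]) (use v in auto)
    also have "\<dots> = \<alpha> * (u \<bullet> v)" unfolding He using u v by simp
    finally have "u \<bullet> v = 0 \<longrightarrow> t = 0" by simp
    thus "\<exists>t y. y \<in> carrier_vec k \<and> v \<bullet> (A *\<^sub>v v) = l * t\<^sup>2 + y \<bullet> (B *\<^sub>v y) \<and>
        v \<bullet> v = t\<^sup>2 + y \<bullet> y \<and> (u \<bullet> v = 0 \<longrightarrow> t = 0)"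
      using y q nrm by blast
  qed
qed

lemma char_poly_root_eigenvectorE:
  fixes A :: "'a :: field mat"
  assumes A: "A \<in> carrier_mat n n" and "poly (char_poly A) k = 0"
  obtains v where "v \<in> carrier_vec n" "v \<noteq> 0\<^sub>v n" "A *\<^sub>v v = k \<cdot>\<^sub>v v"
  using assms eigenvalue_root_char_poly[OF A] by (auto simp: eigenvalue_def eigenvector_def)

text \<open>Induction on the dimension, deflating one eigenvector at a time: the split-off part
  contributes \<open>l * t\<^sup>2\<close> with \<open>\<mu> \<le> l\<close>, and the roots of the
  smaller block are again roots of \<open>A\<close>, so they inherit the bound.\<close>

lemma symmetric_mat_quadratic_form_ge:
  fixes A :: "real mat"
  assumes "A \<in> carrier_mat n n" "A\<^sup>T = A" "v \<in> carrier_vec n"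
    and "\<And>k. poly (char_poly A) k = 0 \<Longrightarrow> \<mu> \<le> k"
  shows "\<mu> * (v \<bullet> v) \<le> v \<bullet> (A *\<^sub>v v)"
  using assms
proof (induction n arbitrary: A v)
  case 0
  thus ?case by (simp add: scalar_prod_def)
next
  case (Suc n)
  obtain l where l: "poly (char_poly A) l = 0"
    using symmetric_mat_has_root[OF Suc.prems(1,2)] by auto
  obtain u where u: "u \<in> carrier_vec (Suc n)" "u \<noteq> 0\<^sub>v (Suc n)" "A *\<^sub>v u = l \<cdot>\<^sub>v u"
    using char_poly_root_eigenvectorE[OF Suc.prems(1) l] .
  obtain B where B: "B \<in> carrier_mat n n" "B\<^sup>T = B" and cp: "char_poly A = [:- l, 1:] * char_poly B"
    and q: "\<And>v. v \<in> carrier_vec (Suc n) \<Longrightarrow> \<exists>t y. y \<in> carrier_vec n \<and>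
       v \<bullet> (A *\<^sub>v v) = l * t\<^sup>2 + y \<bullet> (B *\<^sub>v y) \<and> v \<bullet> v = t\<^sup>2 + y \<bullet> y \<and> (u \<bullet> v = 0 \<longrightarrow> t = 0)"
    using symmetric_mat_deflation[OF Suc.prems(1,2) u] by blast
  obtain t y where y: "y \<in> carrier_vec n"
    and ty: "v \<bullet> (A *\<^sub>v v) = l * t\<^sup>2 + y \<bullet> (B *\<^sub>v y)" "v \<bullet> v = t\<^sup>2 + y \<bullet> y"
    using q[OF Suc.prems(3)] by blast
  have "\<mu> * (y \<bullet> y) \<le> y \<bullet> (B *\<^sub>v y)"
    by (rule Suc.IH[OF B y]) (simp add: Suc.prems(4) cp)
  moreover have "\<mu> * t\<^sup>2 \<le> l * t\<^sup>2"
    using Suc.prems(4)[OF l] by (simp add: mult_right_mono)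
  ultimately show ?case unfolding ty by (simp add: distrib_left)
qed

section \<open>The Rayleigh quotient and algebraic connectivity\<close>

text \<open>Deflating along the constants removes exactly one copy of the eigenvalue 0. As
  \<open>L\<close> is positive semidefinite, that copy may stand first in the sorted list, so entry
  1 for \<open>L\<close> is the least root for \<open>B\<close>. Multiplicities need no case
  distinction: 0 may well be a root of \<open>B\<close> again. Vectors orthogonal to the constants
  live entirely in the block \<open>B\<close>.\<close>

lemma algebraic_connectivity_le_rayleigh:
  fixes L :: "real mat"
  assumes L: "L \<in> carrier_mat N N" and sym: "L\<^sup>T = L" and N: "N > 0"
    and psd: "\<And>v. v \<in> carrier_vec N \<Longrightarrow> 0 \<le> v \<bullet> (L *\<^sub>v v)"
    and L1: "L *\<^sub>v ones_vec N = 0\<^sub>v N"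
    and v: "v \<in> carrier_vec N" and v1: "ones_vec N \<bullet> v = 0"
  shows "algebraic_connectivity L * (v \<bullet> v) \<le> v \<bullet> (L *\<^sub>v v)"
proof -
  obtain k where k: "N = Suc k" using N by (cases N) auto
  have o: "ones_vec N \<in> carrier_vec N" by (simp add: ones_vec_def)
  have "ones_vec N $ 0 \<noteq> (0\<^sub>v N :: real vec) $ 0" using N by (simp add: ones_vec_def)
  hence o0: "ones_vec N \<noteq> 0\<^sub>v N" by auto
  have Lo: "L *\<^sub>v ones_vec N = 0 \<cdot>\<^sub>v ones_vec N" using L1 o by auto
  obtain B where B: "B \<in> carrier_mat k k" "B\<^sup>T = B" and cp: "char_poly L = [:- 0, 1:] * char_poly B"
    and q: "\<And>v. v \<in> carrier_vec N \<Longrightarrow> \<exists>t y. y \<in> carrier_vec k \<and>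
       v \<bullet> (L *\<^sub>v v) = 0 * t\<^sup>2 + y \<bullet> (B *\<^sub>v y) \<and> v \<bullet> v = t\<^sup>2 + y \<bullet> y \<and> (ones_vec N \<bullet> v = 0 \<longrightarrow> t = 0)"
    using symmetric_mat_deflation[OF L[unfolded k] sym o[unfolded k] o0[unfolded k] Lo[unfolded k]]
    unfolding k by blast
  have root_nonneg: "0 \<le> r" if r: "poly (char_poly B) r = 0" for r
  proof -
    have "poly (char_poly L) r = 0" using r by (simp add: cp)
    then obtain z where z: "z \<in> carrier_vec N" "z \<noteq> 0\<^sub>v N" "L *\<^sub>v z = r \<cdot>\<^sub>v z"
      using char_poly_root_eigenvectorE[OF L] by blast
    have "0 \<le> r * (z \<bullet> z)" using psd[OF z(1)] z by simp
    thus ?thesis using real_scalar_prod_self_pos[OF z(1,2)] by (simp add: zero_le_mult_iff)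
  qed
  have B0: "char_poly B \<noteq> 0" using degree_monic_char_poly[OF B(1)] by auto
  have "proots (char_poly L) = add_mset 0 (proots (char_poly B))"
    unfolding cp using B0 by (subst proots_mult) auto
  \<comment> \<open>Nonnegativity of the other roots is what makes inserting 0 put it at the
    head.\<close>
  moreover have "insort 0 xs = 0 # xs" if "\<forall>r \<in> set xs. (0 :: real) \<le> r" for xs
    using that by (cases xs) auto
  ultimately have srt: "sorted_eigenvalues L = 0 # sorted_list_of_multiset (proots (char_poly B))"
    using root_nonneg B0 by (simp add: sorted_eigenvalues_def)
  \<comment> \<open>If \<open>k = 0\<close>, entry 1 of the list lies out of range, but
    \<open>char_poly B\<close> has no roots and the claim is vacuous; \<open>v\<close> is then the
    zero vector.\<close>
  have ac: "algebraic_connectivity L \<le> r" if r: "poly (char_poly B) r = 0" for r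
  proof -
    let ?xs = "sorted_list_of_multiset (proots (char_poly B))"
    have "r \<in> set ?xs" using r B0 by simp
    moreover have "sorted ?xs" by simp
    ultimately have "?xs ! 0 \<le> r" by (cases ?xs) auto
    thus ?thesis by (simp add: algebraic_connectivity_def srt)
  qed
  obtain t y where "y \<in> carrier_vec k" and "v \<bullet> (L *\<^sub>v v) = y \<bullet> (B *\<^sub>v y)" "v \<bullet> v = y \<bullet> y"
    using q[OF v] v1 by auto
  thus ?thesis using symmetric_mat_quadratic_form_ge[OF B _ ac] by simp
qed

text \<open>The minimiser \<open>x\<close> is varied in the direction of its own residual
  \<open>z\<close>. This direction is admissible because \<open>L\<close> is symmetric and kills
  \<open>u\<close>, and the first-order coefficient is twice the squared norm of \<open>z\<close>,
  which must therefore be 0.\<close>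

lemma rayleigh_eq_imp_eigenvector:
  fixes L :: "real mat"
  assumes L: "L \<in> carrier_mat N N" and sym: "L\<^sup>T = L"
    and u: "u \<in> carrier_vec N" and Lu: "L *\<^sub>v u = 0\<^sub>v N"
    and ge: "\<And>v. v \<in> carrier_vec N \<Longrightarrow> u \<bullet> v = 0 \<Longrightarrow> \<mu> * (v \<bullet> v) \<le> v \<bullet> (L *\<^sub>v v)"
    and x: "x \<in> carrier_vec N" and ux: "u \<bullet> x = 0" and eq: "x \<bullet> (L *\<^sub>v x) = \<mu> * (x \<bullet> x)"
  shows "L *\<^sub>v x = \<mu> \<cdot>\<^sub>v x"
proof -
  define z where "z = L *\<^sub>v x - \<mu> \<cdot>\<^sub>v x"
  have Lx: "L *\<^sub>v x \<in> carrier_vec N" using L x by simp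
  have z: "z \<in> carrier_vec N" using Lx x by (simp add: z_def)
  have Lz: "L *\<^sub>v z \<in> carrier_vec N" using L z by simp
  have adj: "(L *\<^sub>v p) \<bullet> q = p \<bullet> (L *\<^sub>v q)" if "p \<in> carrier_vec N" "q \<in> carrier_vec N" for p q
    using scalar_prod_mult_mat_vec[OF L that] sym by simp
  have "u \<bullet> (L *\<^sub>v x) = 0" using adj[OF u x] x by (simp add: Lu)
  hence uz: "u \<bullet> z = 0"
    unfolding z_def using u x Lx ux by (simp add: scalar_prod_minus_distrib[of _ N])
  have zLx: "z \<bullet> (L *\<^sub>v x) - \<mu> * (z \<bullet> x) = z \<bullet> z"
    using z x Lx scalar_prod_minus_distrib[of z N "L *\<^sub>v x" "\<mu> \<cdot>\<^sub>v x"] by (simp add: z_def[symmetric])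
  define G where "G = z \<bullet> z"
  define K where "K = z \<bullet> (L *\<^sub>v z) - \<mu> * (z \<bullet> z)"
  \<comment> \<open>This is the excess of the quadratic form over \<open>\<mu>\<close> times the
    squared norm along \<open>x + t z\<close>; the constant term is gone by
    \<open>eq\<close>.\<close>
  have var: "0 \<le> 2 * t * G + t * t * K" for t
  proof -
    define v where "v = x + t \<cdot>\<^sub>v z"
    have v: "v \<in> carrier_vec N" using x z by (simp add: v_def)
    have "u \<bullet> v = 0"
      unfolding v_def using u x z ux uz by (simp add: scalar_prod_add_distrib[of _ N])
    hence ge': "\<mu> * (v \<bullet> v) \<le> v \<bullet> (L *\<^sub>v v)" using ge v by simp
    have Lv: "L *\<^sub>v v = L *\<^sub>v x + t \<cdot>\<^sub>v (L *\<^sub>v z)"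
      unfolding v_def using L x z
      by (simp add: mult_add_distrib_mat_vec[of _ N N] mult_mat_vec[of _ N N])
    have "x \<bullet> (L *\<^sub>v z) = (L *\<^sub>v x) \<bullet> z" using adj[OF x z] by simp
    also have "\<dots> = z \<bullet> (L *\<^sub>v x)" using comm_scalar_prod[OF Lx z] .
    finally have xLz: "x \<bullet> (L *\<^sub>v z) = z \<bullet> (L *\<^sub>v x)" .
    have "v \<bullet> (L *\<^sub>v v) = x \<bullet> (L *\<^sub>v x) + 2 * t * (z \<bullet> (L *\<^sub>v x)) + t * t * (z \<bullet> (L *\<^sub>v z))"
      unfolding Lv unfolding v_def using x z Lx Lz
      by (simp add: scalar_prod_add_distrib[of _ N] add_scalar_prod_distrib[of _ N] xLz algebra_simps)
    moreover have "v \<bullet> v = x \<bullet> x + 2 * t * (z \<bullet> x) + t * t * (z \<bullet> z)"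
      unfolding v_def using x z comm_scalar_prod[OF x z]
      by (simp add: scalar_prod_add_distrib[of _ N] add_scalar_prod_distrib[of _ N] algebra_simps)
    ultimately have "0 \<le> 2 * t * (z \<bullet> (L *\<^sub>v x) - \<mu> * (z \<bullet> x)) + t * t * K"
      using ge' by (simp add: eq K_def algebra_simps)
    thus ?thesis unfolding zLx G_def .
  qed
  have "z = 0\<^sub>v N"
  proof (rule ccontr)
    assume "z \<noteq> 0\<^sub>v N"
    hence G: "G > 0" unfolding G_def by (rule real_scalar_prod_self_pos[OF z])
    \<comment> \<open>A step short enough for the linear term to win: \<open>s * K\<close> is at
      most \<open>G\<close>, and adding 1 keeps the denominator positive. The contradiction comes
      from \<open>t = - s\<close>.\<close>
    define s where "s = G / (\<bar>K\<bar> + 1)"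
    have s: "s > 0" using G by (simp add: s_def)
    have "s * K \<le> s * (\<bar>K\<bar> + 1)" using s by (intro mult_left_mono) auto
    also have "\<dots> = G" by (simp add: s_def)
    finally have "s * K - 2 * G < 0" using G by simp
    hence "s * (s * K - 2 * G) < 0" using s by (simp add: mult_pos_neg)
    thus False using var[of "- s"] by (simp add: algebra_simps)
  qed
  thus ?thesis
    using L Lx x by (intro eq_vecI) (auto simp: z_def vec_eq_iff)
qed

text \<open>Twice the form equals minus the sum of \<open>M $$ (i, j)\<close> times squared
  differences, since zero row and column sums eliminate the pure squares. The diagonal drops out, so
  the signs off the diagonal decide.\<close>

lemma zero_row_sums_psd:
  fixes M :: "real mat"
  assumes M: "M \<in> carrier_mat N N" and sym: "M\<^sup>T = M" and M1: "M *\<^sub>v ones_vec N = 0\<^sub>v N"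
    and off: "\<And>i j. i < N \<Longrightarrow> j < N \<Longrightarrow> i \<noteq> j \<Longrightarrow> M $$ (i, j) \<le> 0"
    and v: "v \<in> carrier_vec N"
  shows "0 \<le> v \<bullet> (M *\<^sub>v v)"
proof -
  have row: "(\<Sum>j<N. M $$ (i, j)) = 0" if "i < N" for i
    using arg_cong[OF M1, of "\<lambda>v. v $ i"] that M
    by (simp add: ones_vec_def scalar_prod_def atLeast0LessThan)
  have symij: "M $$ (i, j) = M $$ (j, i)" if "i < N" "j < N" for i j
    using sym index_transpose_mat(1)[of i M j] M that by simp
  have col: "(\<Sum>i<N. M $$ (i, j)) = 0" if "j < N" for j
  proof -
    have "(\<Sum>i<N. M $$ (i, j)) = (\<Sum>i<N. M $$ (j, i))"
      using that by (intro sum.cong) (auto simp: symij)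
    thus ?thesis using row that by simp
  qed
  have q: "v \<bullet> (M *\<^sub>v v) = (\<Sum>i<N. \<Sum>j<N. M $$ (i, j) * v $ i * v $ j)"
    using M v by (auto simp: scalar_prod_def atLeast0LessThan sum_distrib_left ac_simps intro!: sum.cong)
  have expand: "M $$ (i, j) * (v $ i - v $ j)\<^sup>2
      = M $$ (i, j) * (v $ i)\<^sup>2 + M $$ (i, j) * (v $ j)\<^sup>2 - 2 * (M $$ (i, j) * v $ i * v $ j)" for i j
    by (simp add: power2_eq_square algebra_simps)
  have "(\<Sum>i<N. \<Sum>j<N. M $$ (i, j) * (v $ i - v $ j)\<^sup>2)
      = (\<Sum>i<N. \<Sum>j<N. M $$ (i, j) * (v $ i)\<^sup>2) + (\<Sum>i<N. \<Sum>j<N. M $$ (i, j) * (v $ j)\<^sup>2)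
        - 2 * (v \<bullet> (M *\<^sub>v v))"
    unfolding q expand by (simp only: sum.distrib sum_subtractf sum_distrib_left[symmetric])
  also have "(\<Sum>i<N. \<Sum>j<N. M $$ (i, j) * (v $ i)\<^sup>2) = 0"
    by (simp add: sum_distrib_right[symmetric] row)
  also have "(\<Sum>i<N. \<Sum>j<N. M $$ (i, j) * (v $ j)\<^sup>2) = 0"
    by (subst sum.swap) (simp add: sum_distrib_right[symmetric] col)
  finally have "2 * (v \<bullet> (M *\<^sub>v v)) = - (\<Sum>i<N. \<Sum>j<N. M $$ (i, j) * (v $ i - v $ j)\<^sup>2)"
    by simp
  moreover have "M $$ (i, j) * (v $ i - v $ j)\<^sup>2 \<le> 0" if "i < N" "j < N" for i j
    using off[OF that] by (cases "i = j") (auto intro: mult_nonpos_nonneg)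
  hence "(\<Sum>i<N. \<Sum>j<N. M $$ (i, j) * (v $ i - v $ j)\<^sup>2) \<le> 0"
    by (intro sum_nonpos) auto
  ultimately show ?thesis by simp
qed

section \<open>The supra-Laplacian\<close>

lemma laplacian_mat_carrier: "laplacian_mat n a E \<in> carrier_mat n n"
  by (auto simp: laplacian_mat_def degree_mat_def adjacency_mat_def mat_diag_def)

lemma laplacian_mat_transpose: "(laplacian_mat n a E)\<^sup>T = laplacian_mat n a E"
  by (rule eq_matI)
    (auto simp: laplacian_mat_def degree_mat_def adjacency_mat_def mat_diag_def insert_commute)

lemma laplacian_mat_offdiag_le_0:
  "i < n \<Longrightarrow> j < n \<Longrightarrow> i \<noteq> j \<Longrightarrow> laplacian_mat n a E $$ (i, j) \<le> 0"
  by (simp add: laplacian_mat_def degree_mat_def adjacency_mat_def mat_diag_def)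

lemma laplacian_mat_mult_ones:
  assumes E: "simple_graph V E" and a: "bij_betw a {0..<n} V"
  shows "laplacian_mat n a E *\<^sub>v ones_vec n = 0\<^sub>v n"
proof (rule eq_vecI)
  fix i assume "i < dim_vec (0\<^sub>v n :: real vec)"
  hence i: "i < n" by simp
  have inj: "inj_on a {0..<n}" and im: "a ` {0..<n} = V" using a by (auto simp: bij_betw_def)
  \<comment> \<open>Neighbours correspond to incident edges, so the degree on the diagonal equals
    the number of ones in the adjacency row.\<close>
  have "bij_betw (\<lambda>j. {a i, a j}) {j. j < n \<and> {a i, a j} \<in> E} {e \<in> E. a i \<in> e}"
    unfolding bij_betw_def
  proof (intro conjI)
    show "inj_on (\<lambda>j. {a i, a j}) {j. j < n \<and> {a i, a j} \<in> E}"
      using inj by (auto simp: inj_on_def doubleton_eq_iff)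
    show "(\<lambda>j. {a i, a j}) ` {j. j < n \<and> {a i, a j} \<in> E} = {e \<in> E. a i \<in> e}"
    proof
      show "{e \<in> E. a i \<in> e} \<subseteq> (\<lambda>j. {a i, a j}) ` {j. j < n \<and> {a i, a j} \<in> E}"
      proof
        fix e assume e: "e \<in> {e \<in> E. a i \<in> e}"
        then obtain y where y: "y \<in> V" "e = {a i, y}"
          using E by (fastforce simp: simple_graph_def)
        then obtain j where "j < n" "y = a j" using im by auto
        thus "e \<in> (\<lambda>j. {a i, a j}) ` {j. j < n \<and> {a i, a j} \<in> E}"
          using e y by auto
      qed
    qed auto
  qed
  hence card: "card {e \<in> E. a i \<in> e} = card {j. j < n \<and> {a i, a j} \<in> E}"
    by (simp add: bij_betw_same_card)
  have "(laplacian_mat n a E *\<^sub>v ones_vec n) $ i = (\<Sum>j<n. laplacian_mat n a E $$ (i, j))"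
    using i laplacian_mat_carrier[of n a E]
    by (simp add: ones_vec_def scalar_prod_def atLeast0LessThan)
  also have "\<dots> = (\<Sum>j<n. (if i = j then real (card {e \<in> E. a i \<in> e}) else 0)
      - (if {a i, a j} \<in> E then 1 else 0))"
    using i by (intro sum.cong)
      (auto simp: laplacian_mat_def degree_mat_def adjacency_mat_def mat_diag_def)
  also have "\<dots> = real (card {e \<in> E. a i \<in> e}) - real (card {j. j < n \<and> {a i, a j} \<in> E})"
  proof -
    have "(\<Sum>j<n. if {a i, a j} \<in> E then 1 else 0) = real (card ({..<n} \<inter> {j. {a i, a j} \<in> E}))"
      by (simp add: sum.If_cases)
    moreover have "{..<n} \<inter> {j. {a i, a j} \<in> E} = {j. j < n \<and> {a i, a j} \<in> E}" by auto
    ultimately show ?thesis using i by (simp add: sum_subtractf)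
  qed
  also have "\<dots> = 0" by (simp add: card)
  finally show "(laplacian_mat n a E *\<^sub>v ones_vec n) $ i = 0\<^sub>v n $ i" using i by simp
qed (use laplacian_mat_carrier[of n a E] in simp)

lemma diag_of_vec_carrier: "v \<in> carrier_vec n \<Longrightarrow> diag_of_vec v \<in> carrier_mat n n"
  by (simp add: diag_of_vec_def mat_diag_def)

lemma diag_of_vec_mult_smult_ones:
  assumes "v \<in> carrier_vec n"
  shows "diag_of_vec v *\<^sub>v (t \<cdot>\<^sub>v ones_vec n) = t \<cdot>\<^sub>v v"
  using assms
  by (intro eq_vecI) (auto simp: diag_of_vec_def mat_diag_def ones_vec_def scalar_prod_def
      if_distrib if_distribR cong: if_cong)

lemma ones_vec_carrier [simp]: "ones_vec n \<in> carrier_vec n"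
  by (simp add: ones_vec_def)

lemma ones_vec_append: "ones_vec (n + m) = ones_vec n @\<^sub>v ones_vec m"
  by (rule eq_vecI) (auto simp: ones_vec_def)

lemma ones_vec_scalar_prod_self: "ones_vec n \<bullet> ones_vec n = real n"
  by (simp add: ones_vec_def scalar_prod_def)

lemma smult_vec_cancel:
  fixes u v :: "'a :: field vec"
  assumes u: "u \<in> carrier_vec n" and v: "v \<in> carrier_vec n" and "d \<noteq> 0"
    and "d \<cdot>\<^sub>v u = d \<cdot>\<^sub>v v"
  shows "u = v"
proof -
  have "inverse d \<cdot>\<^sub>v (d \<cdot>\<^sub>v u) = inverse d \<cdot>\<^sub>v (d \<cdot>\<^sub>v v)" using assms(4) by simp
  thus ?thesis using assms(3) by (simp add: smult_smult_assoc)
qed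

lemma smult_in_vec_span:
  assumes v: "v \<in> carrier_vec n"
  shows "t \<cdot>\<^sub>v v \<in> vec_span n {v}"
proof -
  interpret vec_space "TYPE(real)" n .
  have "v \<in> span {v}" using v in_own_span[of "{v}"] by auto
  thus ?thesis using smult_in_span[of "{v}" v t] v by auto
qed

text \<open>The layers enter the argument only through symmetry, zero row sums and the sign pattern
  of their Laplacians, so the graphs are left behind here.\<close>

locale supra_laplacian_blocks =
  fixes n m :: nat and L1 L2 W :: "real mat"
  assumes L1: "L1 \<in> carrier_mat n n" "L1\<^sup>T = L1" "L1 *\<^sub>v ones_vec n = 0\<^sub>v n"
      "\<And>i j. i < n \<Longrightarrow> j < n \<Longrightarrow> i \<noteq> j \<Longrightarrow> L1 $$ (i, j) \<le> 0"
    and L2: "L2 \<in> carrier_mat m m" "L2\<^sup>T = L2" "L2 *\<^sub>v ones_vec m = 0\<^sub>v m"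
      "\<And>i j. i < m \<Longrightarrow> j < m \<Longrightarrow> i \<noteq> j \<Longrightarrow> L2 $$ (i, j) \<le> 0"
    and W: "W \<in> carrier_mat n m" "\<And>i j. i < n \<Longrightarrow> j < m \<Longrightarrow> 0 \<le> W $$ (i, j)"
begin

abbreviation "L \<equiv> supra_laplacian L1 L2 W"
abbreviation "p \<equiv> W *\<^sub>v ones_vec m"
abbreviation "q \<equiv> W\<^sup>T *\<^sub>v ones_vec n"

lemma p_carrier: "p \<in> carrier_vec n" and q_carrier: "q \<in> carrier_vec m"
  using W(1) by auto

lemma diag_block_carrier: "L1 + diag_of_vec p \<in> carrier_mat n n" "L2 + diag_of_vec q \<in> carrier_mat m m"
  using L1(1) L2(1) diag_of_vec_carrier[OF p_carrier] diag_of_vec_carrier[OF q_carrier] by auto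

lemma off_block_carrier: "- W \<in> carrier_mat n m" "- (W\<^sup>T) \<in> carrier_mat m n"
  using W(1) by auto

lemma L_eq: "L = four_block_mat (L1 + diag_of_vec p) (- W) (- (W\<^sup>T)) (L2 + diag_of_vec q)"
  using W(1) by (simp add: supra_laplacian_def)

lemma L_carrier: "L \<in> carrier_mat (n + m) (n + m)"
  unfolding L_eq using diag_block_carrier by simp

lemma L_transpose: "L\<^sup>T = L"
proof -
  have d: "(diag_of_vec v)\<^sup>T = diag_of_vec v" for v
    by (rule eq_matI) (auto simp: diag_of_vec_def mat_diag_def)
  have "(L1 + diag_of_vec p)\<^sup>T = L1 + diag_of_vec p"
    using transpose_add[OF L1(1) diag_of_vec_carrier[OF p_carrier]] L1(2) d by simp
  moreover have "(L2 + diag_of_vec q)\<^sup>T = L2 + diag_of_vec q"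
    using transpose_add[OF L2(1) diag_of_vec_carrier[OF q_carrier]] L2(2) d by simp
  moreover have "(- W)\<^sup>T = - (W\<^sup>T)" "(- (W\<^sup>T))\<^sup>T = - W"
    by (auto simp: transpose_uminus)
  ultimately show ?thesis
    unfolding L_eq transpose_four_block_mat[OF diag_block_carrier(1) off_block_carrier diag_block_carrier(2)]
    by simp
qed

lemma L_offdiag_le_0:
  assumes "i < n + m" "j < n + m" "i \<noteq> j"
  shows "L $$ (i, j) \<le> 0"
proof -
  have [simp]: "dim_row L1 = n" "dim_col L1 = n" "dim_row L2 = m" "dim_col L2 = m"
      "dim_row W = n" "dim_col W = m"
    using L1(1) L2(1) W(1) by auto
  show ?thesis
    using assms L1(4)[of i j] L2(4)[of "i - n" "j - n"] W(2)
    by (auto simp: L_eq diag_of_vec_def mat_diag_def)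
qed

text \<open>Each layer Laplacian kills constants, leaving only the coupling, which sees the
  difference of the two values. Equal values give the kernel vector; values \<open>1 / n\<close> and
  \<open>- 1 / m\<close> give the test vector.\<close>

lemma L_mult_block_constant:
  "L *\<^sub>v ((s \<cdot>\<^sub>v ones_vec n) @\<^sub>v (t \<cdot>\<^sub>v ones_vec m)) = ((s - t) \<cdot>\<^sub>v p) @\<^sub>v ((t - s) \<cdot>\<^sub>v q)"
proof -
  have c: "s \<cdot>\<^sub>v ones_vec n \<in> carrier_vec n" "t \<cdot>\<^sub>v ones_vec m \<in> carrier_vec m" by auto
  have "L1 *\<^sub>v (s \<cdot>\<^sub>v ones_vec n) = 0\<^sub>v n"
    using L1(3) mult_mat_vec[OF L1(1), of "ones_vec n" s] by auto
  hence "(L1 + diag_of_vec p) *\<^sub>v (s \<cdot>\<^sub>v ones_vec n) = s \<cdot>\<^sub>v p"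
    using add_mult_distrib_mat_vec[OF L1(1) diag_of_vec_carrier[OF p_carrier] c(1)] p_carrier
    by (simp add: diag_of_vec_mult_smult_ones[OF p_carrier])
  moreover have "L2 *\<^sub>v (t \<cdot>\<^sub>v ones_vec m) = 0\<^sub>v m"
    using L2(3) mult_mat_vec[OF L2(1), of "ones_vec m" t] by auto
  hence "(L2 + diag_of_vec q) *\<^sub>v (t \<cdot>\<^sub>v ones_vec m) = t \<cdot>\<^sub>v q"
    using add_mult_distrib_mat_vec[OF L2(1) diag_of_vec_carrier[OF q_carrier] c(2)] q_carrier
    by (simp add: diag_of_vec_mult_smult_ones[OF q_carrier])
  moreover have "(- W) *\<^sub>v (t \<cdot>\<^sub>v ones_vec m) = - (t \<cdot>\<^sub>v p)"
    using W(1) c(2) mult_mat_vec[OF W(1), of "ones_vec m" t] by auto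
  moreover have "(- (W\<^sup>T)) *\<^sub>v (s \<cdot>\<^sub>v ones_vec n) = - (s \<cdot>\<^sub>v q)"
    using W(1) c(1) mult_mat_vec[of "W\<^sup>T" m n "ones_vec n" s] by auto
  moreover have "s \<cdot>\<^sub>v p + - (t \<cdot>\<^sub>v p) = (s - t) \<cdot>\<^sub>v p" "- (s \<cdot>\<^sub>v q) + t \<cdot>\<^sub>v q = (t - s) \<cdot>\<^sub>v q"
    using p_carrier q_carrier by (auto intro!: eq_vecI simp: algebra_simps)
  ultimately show ?thesis
    unfolding L_eq four_block_mat_mult_vec[OF diag_block_carrier(1) off_block_carrier diag_block_carrier(2) c]
    by simp
qed

lemma L_mult_ones: "L *\<^sub>v ones_vec (n + m) = 0\<^sub>v (n + m)"
proof -
  have "0 \<cdot>\<^sub>v v = 0\<^sub>v k" if "v \<in> carrier_vec k" for v :: "real vec" and k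
    using that by (intro eq_vecI) auto
  from this[OF p_carrier] this[OF q_carrier] have "0 \<cdot>\<^sub>v p = 0\<^sub>v n" "0 \<cdot>\<^sub>v q = 0\<^sub>v m" .
  moreover have "(0\<^sub>v n :: real vec) @\<^sub>v 0\<^sub>v m = 0\<^sub>v (n + m)" by auto
  ultimately show ?thesis
    using L_mult_block_constant[of 1 1] by (simp add: ones_vec_append)
qed

text \<open>Equality makes the test vector \<open>x\<close> an eigenvector; comparing the two layers
  of \<open>L x\<close> yields the sums, with the total \<open>c\<close> spread evenly over rows and
  over columns.\<close>

lemma constant_sums_of_connectivity_eq:
  assumes n: "n \<ge> 1" and m: "m \<ge> 1" and c: "ones_vec n \<bullet> p = c"
    and eq: "algebraic_connectivity L = (1 / real n + 1 / real m) * c"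
  shows "p = (c / real n) \<cdot>\<^sub>v ones_vec n" and "q = (c / real m) \<cdot>\<^sub>v ones_vec m"
proof -
  define d where "d = 1 / real n + 1 / real m"
  have d: "d > 0" using n m by (simp add: d_def add_pos_pos)
  have d': "1 / real n - - (1 / real m) = d" "- (1 / real m) - 1 / real n = - d"
    by (simp_all add: d_def)
  define x where "x = ((1 / real n) \<cdot>\<^sub>v ones_vec n) @\<^sub>v ((- (1 / real m)) \<cdot>\<^sub>v ones_vec m)"
  have x: "x \<in> carrier_vec (n + m)" by (simp add: x_def)
  have Lx: "L *\<^sub>v x = (d \<cdot>\<^sub>v p) @\<^sub>v ((- d) \<cdot>\<^sub>v q)"
    unfolding x_def L_mult_block_constant d' ..
  \<comment> \<open>One formula for three products: the squared norm of \<open>x\<close>, the form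
    \<open>x \<bullet> (L *\<^sub>v x)\<close>, and orthogonality to the constants.\<close>
  have x_prod: "x \<bullet> ((s \<cdot>\<^sub>v P) @\<^sub>v (t \<cdot>\<^sub>v Q))
      = 1 / real n * (s * (ones_vec n \<bullet> P)) - 1 / real m * (t * (ones_vec m \<bullet> Q))"
    if "P \<in> carrier_vec n" "Q \<in> carrier_vec m" for s t P Q
    unfolding x_def using that by (subst scalar_prod_append[of _ n _ m]) auto
  have "ones_vec m \<bullet> q = p \<bullet> ones_vec n"
    using scalar_prod_mult_mat_vec[OF W(1), of "ones_vec m" "ones_vec n"] by simp
  also have "\<dots> = c" using comm_scalar_prod[OF p_carrier, of "ones_vec n"] c by simp
  finally have qc: "ones_vec m \<bullet> q = c" .
  have "x \<bullet> x = d"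
    using x_prod[of "ones_vec n" "ones_vec m" "1 / real n" "- (1 / real m)"] n m
    by (simp add: x_def[symmetric] ones_vec_scalar_prod_self d_def)
  moreover have "x \<bullet> (L *\<^sub>v x) = d * c * d"
    unfolding Lx x_prod[OF p_carrier q_carrier] c qc by (simp add: d_def algebra_simps)
  ultimately have q_eq: "x \<bullet> (L *\<^sub>v x) = (d * c) * (x \<bullet> x)" by simp
  have "ones_vec (n + m) \<bullet> x = x \<bullet> ((1 \<cdot>\<^sub>v ones_vec n) @\<^sub>v (1 \<cdot>\<^sub>v ones_vec m))"
    using comm_scalar_prod[OF x, of "ones_vec (n + m)"] by (simp add: ones_vec_append)
  also have "\<dots> = 0"
    unfolding x_prod[OF ones_vec_carrier ones_vec_carrier] using n m
    by (simp add: ones_vec_scalar_prod_self)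
  finally have x1: "ones_vec (n + m) \<bullet> x = 0" .
  have "algebraic_connectivity L = d * c" using eq by (simp add: d_def)
  hence ge: "d * c * (v \<bullet> v) \<le> v \<bullet> (L *\<^sub>v v)"
    if "v \<in> carrier_vec (n + m)" "ones_vec (n + m) \<bullet> v = 0" for v
    using algebraic_connectivity_le_rayleigh[OF L_carrier L_transpose _ _ L_mult_ones that]
      zero_row_sums_psd[OF L_carrier L_transpose L_mult_ones L_offdiag_le_0] n
    by simp
  have "L *\<^sub>v x = (d * c) \<cdot>\<^sub>v x"
    by (rule rayleigh_eq_imp_eigenvector[OF L_carrier L_transpose ones_vec_carrier L_mult_ones ge x x1 q_eq])
  \<comment> \<open>The eigenvalue is regrouped so that the layers carry the factors
    \<open>d\<close> and \<open>- d\<close> of \<open>Lx\<close>, which can then be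
    cancelled.\<close>
  also have "\<dots> = (d \<cdot>\<^sub>v ((c / real n) \<cdot>\<^sub>v ones_vec n)) @\<^sub>v ((- d) \<cdot>\<^sub>v ((c / real m) \<cdot>\<^sub>v ones_vec m))"
    unfolding x_def by (rule eq_vecI) (auto simp: ones_vec_def)
  finally have ev: "d \<cdot>\<^sub>v p = d \<cdot>\<^sub>v ((c / real n) \<cdot>\<^sub>v ones_vec n)"
      "(- d) \<cdot>\<^sub>v q = (- d) \<cdot>\<^sub>v ((c / real m) \<cdot>\<^sub>v ones_vec m)"
    unfolding Lx using append_vec_eq[of "d \<cdot>\<^sub>v p" n "d \<cdot>\<^sub>v ((c / real n) \<cdot>\<^sub>v ones_vec n)"] p_carrier
    by (simp_all only: smult_carrier_vec ones_vec_carrier)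
  show "p = (c / real n) \<cdot>\<^sub>v ones_vec n"
    using smult_vec_cancel[OF p_carrier _ _ ev(1)] d by simp
  show "q = (c / real m) \<cdot>\<^sub>v ones_vec m"
    using smult_vec_cancel[OF q_carrier _ _ ev(2)] d by simp
qed

end

theorem lemma3p2:
  fixes V1 V2 :: "'v set" and E1 E2 E3 :: "'v set set"
    and n m :: nat and a b :: "nat \<Rightarrow> 'v"
    and w :: "'v set \<Rightarrow> real" and c :: real and W L1 L2 :: "real mat"
  defines "W \<equiv> interlayer_mat n a m b E3 w"
    and "L1 \<equiv> laplacian_mat n a E1"
    and "L2 \<equiv> laplacian_mat m b E2"
  assumes "simple_graph V1 E1" and "simple_graph V2 E2"
    and "V1 \<inter> V2 = {}"
    and "n \<ge> 1" and "m \<ge> 1"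
    and "bij_betw a {0..<n} V1" and "bij_betw b {0..<m} V2"
    and "E3 \<subseteq> {{i, j} | i j. i \<in> V1 \<and> j \<in> V2}" and "E3 \<noteq> {}"
    and "\<forall>e \<in> E3. w e \<ge> 0"
    and "c \<ge> 0"
    and "ones_vec n \<bullet> (W *\<^sub>v ones_vec m) = c"
    and "algebraic_connectivity (supra_laplacian L1 L2 W) = (1 / real n + 1 / real m) * c"
  shows "W *\<^sub>v ones_vec m \<in> vec_span n {ones_vec n} \<and>
         W\<^sup>T *\<^sub>v ones_vec n \<in> vec_span m {ones_vec m}"
proof -
  interpret supra_laplacian_blocks n m L1 L2 W
  proof
    show "W \<in> carrier_mat n m" by (simp add: W_def interlayer_mat_def)
    show "0 \<le> W $$ (i, j)" if "i < n" "j < m" for i j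
      using that assms(13) by (simp add: W_def interlayer_mat_def)
  qed (use laplacian_mat_mult_ones assms(4,5,9,10) in
      \<open>auto simp: L1_def L2_def laplacian_mat_carrier laplacian_mat_transpose laplacian_mat_offdiag_le_0\<close>)
  show ?thesis
    using constant_sums_of_connectivity_eq[OF assms(7,8,15,16)] smult_in_vec_span by simp
qed

end
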